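(* Let $A\in M_n(\mathbb{C})$ and let $\lambda$ be an eigenvalue of $A$ having two different Jordan blocks $J_r(\lambda)$ and $J_s(\lambda)$ in the Jordan form of $A$, of sizes $r$ and $s$. Let $x_1,\dots,x_r$ and $y_1,\dots,y_s$ be Jordan chains of $A$ for these two blocks respectively. Let $1\le m\le r$ and $1\le t\le s$ be integers, and let $b\in\mathbb{C}^n$ with $b^*x_1\neq0$. Then $A+x_mb^*$ has a generalized eigenvector $v_t$ of rank $t$ associated with $\lambda$, given as follows. (1) When $t\le m$, $$v_t=y_t+\sum_{j=1}^{t}\beta_j^{(t)}x_j,$$ where the coefficients satisfy the recurrence $$\beta_{j+1}^{(t)}=\beta_j^{(t-1)},\qquad 1\le j\le t-1,$$ and $$\beta_1^{(t)}=\frac{-b^*y_t-\sum_{j=2}^{t}\beta_{j-1}^{(t-1)}(b^*x_j)}{b^*x_1}.$$ (2) When $t>m$, $$v_t=y_t+\sum_{j=1}^{m}\beta_j^{(t)}x_j,$$ where $\beta_{j+1}^{(t)}=\beta_j^{(t-1)}$ for $1\le j\le m-1$, and $$\beta_1^{(t)}=\frac{\beta_m^{(t-1)}-b^*y_t-\sum_{j=2}^{m}\beta_{j-1}^{(t-1)}(b^*x_j)}{b^*x_1}.$$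
   Context: $b^*$ denotes the conjugate transpose of $b$. A vector $x$ is a generalized eigenvector of rank $k$ of a matrix $M$ for the eigenvalue $\lambda$ if $(M-\lambda I)^k x=0$ and $(M-\lambda I)^{k-1}x\neq0$. The chains consist of generalized eigenvectors $x_j$, $y_j$ of $A$ of rank $j$ with $Ax_j=\lambda x_j+x_{j-1}$ ($1\le j\le r$) and $Ay_j=\lambda y_j+y_{j-1}$ ($1\le j\le s$), where $x_0=y_0=0$; since they belong to different Jordan blocks (both part of one Jordan basis of $A$), the vectors $x_1,\dots,x_r,y_1,\dots,y_s$ are linearly independent. The scalars $\beta_j^{(t)}$ are defined recursively in $t$ (for levels $1,2,\dots,t$, each level using the formulas of case (1) or (2) according to its value); empty sums are $0$, and any scalar or vector with a subscript or superscript $0$ is $0$. *)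

theory Defs
  imports
    "Jordan_Normal_Form.Jordan_Normal_Form"
    "Jordan_Normal_Form.Char_Poly"
    "Jordan_Normal_Form.VS_Connect"
    Complex_Main
begin

(* Convention: for vectors b, x over the complex numbers, the scalar "b* x" is the library's
   x \<bullet>c b, i.e. x \<bullet> conjugate b; the conjugate sits on the second argument. *)

definition outer_star :: "complex vec \<Rightarrow> complex vec \<Rightarrow> complex mat" where
  "outer_star x b = mat (dim_vec x) (dim_vec b) (\<lambda>(i, j). x $ i * cnj (b $ j))"

(* char_matrix M e is the library's name for M - e I. For k = 0 the two conditions
   contradict each other, so a rank is always at least 1. *)
definition gen_eigenvector :: "complex mat \<Rightarrow> complex \<Rightarrow> nat \<Rightarrow> complex vec \<Rightarrow> bool" where
  "gen_eigenvector M e k v \<longleftrightarrow>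
     v \<in> carrier_vec (dim_row M) \<and>
     (char_matrix M e ^\<^sub>m k) *\<^sub>v v = 0\<^sub>v (dim_row M) \<and>
     (char_matrix M e ^\<^sub>m (k - 1)) *\<^sub>v v \<noteq> 0\<^sub>v (dim_row M)"

(* A chain of length r is indexed by 1..r; the value at 0 is the zero vector. *)
definition jordan_chain :: "complex mat \<Rightarrow> complex \<Rightarrow> nat \<Rightarrow> (nat \<Rightarrow> complex vec) \<Rightarrow> bool" where
  "jordan_chain A e r x \<longleftrightarrow>
     x 0 = 0\<^sub>v (dim_row A) \<and>
     (\<forall>j\<in>{1..r}. gen_eigenvector A e j (x j) \<and> A *\<^sub>v x j = e \<cdot>\<^sub>v x j + x (j - 1))"

(* n_as lists the blocks (size, eigenvalue) of a Jordan form as in jordan_nf, and X i is the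
   chain belonging to the i-th block. All chain vectors together, as a family (hence the
   injectivity), form a basis of the whole space. *)
definition jordan_basis ::
  "complex mat \<Rightarrow> (nat \<times> complex) list \<Rightarrow> (nat \<Rightarrow> nat \<Rightarrow> complex vec) \<Rightarrow> bool" where
  "jordan_basis A n_as X \<longleftrightarrow>
     (\<forall>i<length n_as. jordan_chain A (snd (n_as ! i)) (fst (n_as ! i)) (X i)) \<and>
     (let I = (SIGMA i:{..<length n_as}. {1..fst (n_as ! i)}) in
        inj_on (\<lambda>(i, j). X i j) I \<and>
        vectorspace.basis class_ring (module_vec TYPE(complex) (dim_row A))
          ((\<lambda>(i, j). X i j) ` I))"

(* beta b x y m t j is the coefficient at level t with index j. Only the indices
   1 <= j <= min t m have a meaning, and the recursion at such an index never consults
   one outside that range except at level 0, where every coefficient is 0 by convention. *)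
fun beta :: "complex vec \<Rightarrow> (nat \<Rightarrow> complex vec) \<Rightarrow> (nat \<Rightarrow> complex vec) \<Rightarrow>
    nat \<Rightarrow> nat \<Rightarrow> nat \<Rightarrow> complex" where
  "beta b x y m 0 j = 0"
| "beta b x y m (Suc t) j =
    (if j = 0 then 0
     else if j = 1 then
       (if Suc t \<le> m
        then (- (y (Suc t) \<bullet>c b)
              - (\<Sum>i = 2..Suc t. beta b x y m t (i - 1) * (x i \<bullet>c b))) / (x 1 \<bullet>c b)
        else (beta b x y m t m - (y (Suc t) \<bullet>c b)
              - (\<Sum>i = 2..m. beta b x y m t (i - 1) * (x i \<bullet>c b))) / (x 1 \<bullet>c b))
     else beta b x y m t (j - 1))"

end

theory Submission
  imports Defs
begin

text \<open>Put \<open>N = A + x\<^sub>m b\<^sup>* - \<lambda>\<close>. The recurrence for the coefficients says exactly that \<open>N\<close> maps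
  \<open>v\<^sub>t\<close> to \<open>v\<^sub>t\<^sub>-\<^sub>1\<close>, with \<open>v\<^sub>0 = 0\<close>: the shift of the coefficients matches the action of \<open>A - \<lambda>\<close> on
  the chain \<open>x\<close>, and the formula for the first coefficient gives \<open>b\<^sup>* v\<^sub>t\<close> the value that is needed in
  front of \<open>x\<^sub>m\<close> (zero if \<open>t \<le> m\<close>, the \<open>m\<close>-th coefficient of level \<open>t - 1\<close> otherwise). Hence
  \<open>N\<^sup>t v\<^sub>t = 0\<close>, while \<open>N\<^sup>t\<^sup>-\<^sup>1 v\<^sub>t = v\<^sub>1\<close> is nonzero because \<open>x\<^sub>1\<close> and \<open>y\<^sub>1\<close> are linearly
  independent.\<close>

text \<open>Vanishing would be a dependence with coefficient 1 at \<open>v\<close>, hence nontrivial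
  whatever \<open>c\<close> is. This serves to show that \<open>v 1\<close> is nonzero in the
  theorem.\<close>

lemma (in vec_space) lin_indpt_add_smult_ne_0:
  assumes S: "S \<subseteq> carrier_vec n" "\<not> lin_dep S"
    and uv: "u \<in> S" "v \<in> S" "u \<noteq> v"
  shows "v + c \<cdot>\<^sub>v u \<noteq> 0\<^sub>v n"
proof
  assume eq: "v + c \<cdot>\<^sub>v u = 0\<^sub>v n"
  let ?a = "\<lambda>w. if w = v then 1 else c"
  have car: "u \<in> carrier_vec n" "v \<in> carrier_vec n"
    using S uv by auto
  have "lincomb ?a {v, u} = v + c \<cdot>\<^sub>v u"
    unfolding lincomb_def using car uv by (subst finsum_insert) auto
  then have "lincomb ?a {v, u} = 0\<^sub>v n"
    using eq by simp
  then have "lin_dep S"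
    unfolding lin_dep_def using uv
    by (intro exI[of _ "{v, u}"] exI[of _ ?a] exI[of _ v]) auto
  then show False
    using S by blast
qed

lemma mult_mat_finsum_vec:
  fixes M :: "'a :: comm_semiring_0 mat"
  assumes "M \<in> carrier_mat nr n" and "finite I" and "f \<in> I \<rightarrow> carrier_vec n"
  shows "M *\<^sub>v finsum_vec TYPE('a) n f I = finsum_vec TYPE('a) nr (\<lambda>j. M *\<^sub>v f j) I"
  using assms(2,3)
proof (induction I rule: finite_induct)
  case empty
  then show ?case
    using assms(1) by (auto simp: finsum_vec_empty)
next
  case (insert i I)
  have "finsum_vec TYPE('a) n f I \<in> carrier_vec n"
    using insert.prems by (intro finsum_vec_closed) auto
  moreover have "(\<lambda>j. M *\<^sub>v f j) \<in> I \<rightarrow> carrier_vec nr" "M *\<^sub>v f i \<in> carrier_vec nr"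
    using insert.prems by (auto intro!: mult_mat_vec_carrier[OF assms(1)])
  ultimately show ?case
    using insert assms(1)
    by (simp add: finsum_vec_insert Pi_def mult_add_distrib_mat_vec)
qed

section \<open>Action of a rank-one perturbation\<close>

lemma outer_star_carrier:
  "u \<in> carrier_vec n \<Longrightarrow> b \<in> carrier_vec k \<Longrightarrow> outer_star u b \<in> carrier_mat n k"
  by (auto simp: outer_star_def)

lemma outer_star_mult_vec:
  assumes "u \<in> carrier_vec n" "b \<in> carrier_vec k" "w \<in> carrier_vec k"
  shows "outer_star u b *\<^sub>v w = (w \<bullet>c b) \<cdot>\<^sub>v u"
  using assms
  by (intro eq_vecI) (auto simp: outer_star_def scalar_prod_def sum_distrib_left mult_ac)

lemma char_matrix_mult_vec:
  assumes "A \<in> carrier_mat n n" "w \<in> carrier_vec n"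
  shows "char_matrix A e *\<^sub>v w = A *\<^sub>v w - e \<cdot>\<^sub>v w"
  using assms unfolding char_matrix_def
  by (intro eq_vecI) (auto simp: add_scalar_prod_distrib[of _ n])

lemma char_matrix_rank_one_mult_vec:
  assumes "A \<in> carrier_mat n n" "u \<in> carrier_vec n" "b \<in> carrier_vec n" "w \<in> carrier_vec n"
  shows "char_matrix (A + outer_star u b) e *\<^sub>v w = char_matrix A e *\<^sub>v w + (w \<bullet>c b) \<cdot>\<^sub>v u"
proof -
  have "outer_star u b \<in> carrier_mat n n"
    using assms by (simp add: outer_star_carrier)
  then show ?thesis
    using assms
    by (intro eq_vecI)
      (auto simp: char_matrix_mult_vec[of _ n] add_mult_distrib_mat_vec[of _ n n]
        outer_star_mult_vec[of _ n _ n])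
qed

section \<open>Jordan chains and ranks\<close>

lemma jordan_chainD:
  assumes "A \<in> carrier_mat n n" and "jordan_chain A e r x"
  shows "x 0 = 0\<^sub>v n"
    and "j \<le> r \<Longrightarrow> x j \<in> carrier_vec n"
    and "Suc j \<le> r \<Longrightarrow> char_matrix A e *\<^sub>v x (Suc j) = x j"
proof -
  show x0: "x 0 = 0\<^sub>v n"
    using assms by (auto simp: jordan_chain_def)
  show car: "x j \<in> carrier_vec n" if "j \<le> r" for j
    using assms x0 that by (cases j) (auto simp: jordan_chain_def gen_eigenvector_def)
  show "char_matrix A e *\<^sub>v x (Suc j) = x j" if "Suc j \<le> r"
  proof -
    have "A *\<^sub>v x (Suc j) = e \<cdot>\<^sub>v x (Suc j) + x j"
      using assms(2) that by (auto simp: jordan_chain_def)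
    then show ?thesis
      using assms(1) car[of j] car[of "Suc j"] that
      by (auto simp: char_matrix_mult_vec[of _ n])
  qed
qed

lemma pow_mat_mult_vec_chain:
  assumes N: "N \<in> carrier_mat n n" and v: "\<And>k. k \<le> l \<Longrightarrow> v k \<in> carrier_vec n"
    and step: "\<And>k. Suc k \<le> l \<Longrightarrow> N *\<^sub>v v (Suc k) = v k"
  shows "i + k \<le> l \<Longrightarrow> (N ^\<^sub>m i) *\<^sub>v v (i + k) = v k"
proof (induction i)
  case 0
  then show ?case
    using N v by simp
next
  case (Suc i)
  have "(N ^\<^sub>m Suc i) *\<^sub>v v (Suc i + k) = (N ^\<^sub>m i) *\<^sub>v (N *\<^sub>v v (Suc (i + k)))"
    using N v Suc.prems pow_carrier_mat[OF N] by (simp add: assoc_mult_mat_vec[of _ n n _ n])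
  then show ?case
    using Suc step by simp
qed

text \<open>Each factor of the shifted matrix lowers the index by one, so the power \<open>t\<close>
  reaches \<open>v 0\<close> and the power \<open>t - 1\<close> stops at \<open>v 1\<close>. The
  bound \<open>1 \<le> t\<close> makes \<open>(t - 1) + 1 = t\<close> hold for truncated
  subtraction.\<close>

lemma gen_eigenvector_chain:
  assumes M: "M \<in> carrier_mat n n" and v: "\<And>k. k \<le> t \<Longrightarrow> v k \<in> carrier_vec n"
    and step: "\<And>k. Suc k \<le> t \<Longrightarrow> char_matrix M e *\<^sub>v v (Suc k) = v k"
    and "v 0 = 0\<^sub>v n" and "v 1 \<noteq> 0\<^sub>v n" and "1 \<le> t"
  shows "gen_eigenvector M e t (v t)"
proof -
  have N: "char_matrix M e \<in> carrier_mat n n"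
    using M by simp
  note pow = pow_mat_mult_vec_chain[of "char_matrix M e" n t v, OF N v step]
  show ?thesis
    using pow[of t 0] pow[of "t - 1" 1] assms by (auto simp: gen_eigenvector_def)
qed

section \<open>Identities for the coefficients\<close>

text \<open>The summand for \<open>j = 1\<close> cancels the denominator of the first coefficient;
  its numerator then cancels all other terms except, in the case \<open>m < Suc k\<close>, the
  coefficient \<open>beta b x y m k m\<close>.\<close>

lemma beta_scalar_prod:
  assumes m: "1 \<le> m" and "x 1 \<bullet>c b \<noteq> 0"
  shows "y (Suc k) \<bullet>c b + (\<Sum>j = 1..min (Suc k) m. beta b x y m (Suc k) j * (x j \<bullet>c b))
    = (if m \<le> k then beta b x y m k m else 0)"
proof -
  have split: "{1..min (Suc k) m} = insert 1 {2..min (Suc k) m}"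
    using m by auto
  have "(\<Sum>j = 2..min (Suc k) m. beta b x y m (Suc k) j * (x j \<bullet>c b))
      = (\<Sum>j = 2..min (Suc k) m. beta b x y m k (j - 1) * (x j \<bullet>c b))"
    by (intro sum.cong) auto
  then show ?thesis
    unfolding split using assms(2)
    by (cases "m \<le> k") (simp_all add: min_def field_simps)
qed

text \<open>Shifting the index turns coefficients of level \<open>Suc k\<close> into those of level
  \<open>k\<close>. If \<open>m \<le> k\<close>, the range stops at \<open>m\<close> on both levels,
  so the shift misses the coefficient of \<open>z m\<close>; the extra term restores it. Later
  \<open>z j\<close> is a fixed coordinate of \<open>x j\<close>.\<close>

lemma beta_shift_sum:
  fixes z :: "nat \<Rightarrow> complex"
  assumes "1 \<le> m" and "z 0 = 0"
  shows "(\<Sum>j = 1..min (Suc k) m. beta b x y m (Suc k) j * z (j - 1))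
      + (if m \<le> k then beta b x y m k m else 0) * z m
    = (\<Sum>j = 1..min k m. beta b x y m k j * z j)"
proof -
  obtain l where l: "min (Suc k) m = Suc l"
    using assms(1) by (cases "min (Suc k) m") auto
  have "(\<Sum>j = 1..Suc l. beta b x y m (Suc k) j * z (j - 1))
      = (\<Sum>j = 0..l. beta b x y m (Suc k) (Suc j) * z j)"
    by (simp only: One_nat_def sum.shift_bounds_cl_Suc_ivl diff_Suc_Suc diff_zero)
  \<comment> \<open>The term for \<open>j = 0\<close> carries the first coefficient, which is not a
    shift; \<open>z 0 = 0\<close> removes it. What remains has index \<open>Suc j\<close> at least
    2, where \<open>beta\<close> simply shifts.\<close>
  also have "\<dots> = (\<Sum>j = 1..l. beta b x y m (Suc k) (Suc j) * z j)"
    using assms(2) by (simp add: sum.atLeast_Suc_atMost)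
  also have "\<dots> = (\<Sum>j = 1..l. beta b x y m k j * z j)"
    by (intro sum.cong) auto
  finally have eq: "(\<Sum>j = 1..Suc l. beta b x y m (Suc k) j * z (j - 1))
      = (\<Sum>j = 1..l. beta b x y m k j * z j)" .
  show ?thesis
  proof (cases "m \<le> k")
    case True
    then have "m = Suc l" "min k m = Suc l"
      using l by auto
    then show ?thesis
      unfolding l eq using True by simp
  next
    case False
    then have "min k m = l"
      using l by auto
    then show ?thesis
      unfolding l eq using False by simp
  qed
qed

theorem theorem3p6:
  fixes A :: "complex mat" and lam :: complex and b :: "complex vec"
    and n r s m t p q :: nat
    and n_as :: "(nat \<times> complex) list"
    and X :: "nat \<Rightarrow> nat \<Rightarrow> complex vec"
    and x y :: "nat \<Rightarrow> complex vec"
  assumes "A \<in> carrier_mat n n"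
    and "eigenvalue A lam"
    and "jordan_nf A n_as"
    and "p < length n_as" and "q < length n_as" and "p \<noteq> q"
    and "n_as ! p = (r, lam)" and "n_as ! q = (s, lam)"
    and "jordan_basis A n_as X"
    and "x = X p" and "y = X q"
    and "1 \<le> m" and "m \<le> r" and "1 \<le> t" and "t \<le> s"
    and "b \<in> carrier_vec n"
    and "x 1 \<bullet>c b \<noteq> 0"
  shows "(t \<le> m \<longrightarrow>
           gen_eigenvector (A + outer_star (x m) b) lam t
             (y t + finsum_vec TYPE(complex) n (\<lambda>j. beta b x y m t j \<cdot>\<^sub>v x j) {1..t})) \<and>
         (m < t \<longrightarrow>
           gen_eigenvector (A + outer_star (x m) b) lam t
             (y t + finsum_vec TYPE(complex) n (\<lambda>j. beta b x y m t j \<cdot>\<^sub>v x j) {1..m}))"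
proof -
  let ?M = "A + outer_star (x m) b"
  \<comment> \<open>The bound \<open>min k m\<close> covers both cases of the theorem at once, and
    lets one chain pass from levels \<open>k \<le> m\<close> to levels beyond
    \<open>m\<close>.\<close>
  define S where "S k = finsum_vec TYPE(complex) n (\<lambda>j. beta b x y m k j \<cdot>\<^sub>v x j) {1..min k m}" for k
  define v where "v k = y k + S k" for k
  interpret vec_space "TYPE(complex)" n .
  let ?I = "SIGMA i:{..<length n_as}. {1..fst (n_as ! i)}"
  let ?B = "(\<lambda>(i, j). X i j) ` ?I"
  have inj: "inj_on (\<lambda>(i, j). X i j) ?I" and bas: "basis ?B"
    using assms(1,9) by (simp_all add: jordan_basis_def Let_def)
  have cx: "jordan_chain A lam r x" and cy: "jordan_chain A lam s y"
    using assms(4-11) by (auto simp: jordan_basis_def)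
  note x = jordan_chainD[OF assms(1) cx] and y = jordan_chainD[OF assms(1) cy]
  have M: "?M \<in> carrier_mat n n"
    using assms x(2)[of m] by (simp add: outer_star_carrier)
  have bx: "(\<lambda>j. beta b x y m k j \<cdot>\<^sub>v x j) \<in> {1..min k m} \<rightarrow> carrier_vec n" for k
    using assms(13) x(2) by auto
  have S: "S k \<in> carrier_vec n" for k
    unfolding S_def using bx by (intro finsum_vec_closed) auto
  have v: "v k \<in> carrier_vec n" if "k \<le> t" for k
    unfolding v_def using S y(2)[of k] that assms(15) by auto
  have b: "conjugate b \<in> carrier_vec n"
    using assms(16) by simp
  have S_b: "S k \<bullet>c b = (\<Sum>j = 1..min k m. beta b x y m k j * (x j \<bullet>c b))" for k
  proof -
    have "S k \<bullet>c b = (\<Sum>j = 1..min k m. (beta b x y m k j \<cdot>\<^sub>v x j) \<bullet>c b)"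
      unfolding S_def finsum_vec using bx b by (intro finsum_scalar_prod_sum) auto
    also have "\<dots> = (\<Sum>j = 1..min k m. beta b x y m k j * (x j \<bullet>c b))"
      using assms(13) x(2) b by (intro sum.cong) (auto intro!: smult_scalar_prod_distrib[of _ n])
    finally show ?thesis .
  qed
  \<comment> \<open>Coordinates turn vector sums into sums of complex numbers, to which
    \<open>beta_shift_sum\<close> applies.\<close>
  have S_idx: "S k $ i = (\<Sum>j = 1..min k m. beta b x y m k j * x j $ i)" if "i < n" for k i
  proof -
    have "S k $ i = (\<Sum>j = 1..min k m. (beta b x y m k j \<cdot>\<^sub>v x j) $ i)"
      unfolding S_def using bx that by (intro index_finsum_vec) auto
    also have "\<dots> = (\<Sum>j = 1..min k m. beta b x y m k j * x j $ i)"
      using assms(13) x(2)[THEN carrier_vecD] that by (intro sum.cong) auto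
    finally show ?thesis .
  qed
  have N: "char_matrix A lam \<in> carrier_mat n n"
    using assms(1) by simp
  have NS_idx: "(char_matrix A lam *\<^sub>v S k) $ i
      = (\<Sum>j = 1..min k m. beta b x y m k j * x (j - 1) $ i)" if "i < n" for k i
  proof -
    let ?g = "\<lambda>j. char_matrix A lam *\<^sub>v (beta b x y m k j \<cdot>\<^sub>v x j)"
    have "char_matrix A lam *\<^sub>v S k = finsum_vec TYPE(complex) n ?g {1..min k m}"
      unfolding S_def using bx N by (intro mult_mat_finsum_vec) auto
    moreover have "?g \<in> {1..min k m} \<rightarrow> carrier_vec n"
      using bx[of k] by (auto intro!: mult_mat_vec_carrier[OF N])
    ultimately have "(char_matrix A lam *\<^sub>v S k) $ i = (\<Sum>j = 1..min k m. ?g j $ i)"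
      using that by (simp only: index_finsum_vec finite_atLeastAtMost)
    also have "\<dots> = (\<Sum>j = 1..min k m. beta b x y m k j * x (j - 1) $ i)"
    proof (intro sum.cong refl)
      fix j assume j: "j \<in> {1..min k m}"
      then obtain i' where i': "j = Suc i'" "Suc i' \<le> r"
        using assms(13) by (cases j) auto
      then have "?g j = beta b x y m k j \<cdot>\<^sub>v x (j - 1)"
        using mult_mat_vec[OF N x(2)[of j]] x(3)[of i'] by simp
      then show "?g j $ i = beta b x y m k j * x (j - 1) $ i"
        using x(2)[of i'] i' that by simp
    qed
    finally show ?thesis .
  qed
  have step: "char_matrix ?M lam *\<^sub>v v (Suc k) = v k" if k: "Suc k \<le> t" for k
  proof -
    \<comment> \<open>The value of \<open>v (Suc k) \<bullet>c b\<close>, that is, the factor with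
      which the perturbation contributes \<open>x m\<close>.\<close>
    let ?c = "if m \<le> k then beta b x y m k m else 0"
    have yc: "y (Suc k) \<in> carrier_vec n" "y k \<in> carrier_vec n" and xm: "x m \<in> carrier_vec n"
      using y(2)[of k] y(2)[of "Suc k"] x(2)[of m] k assms(13,15) by auto
    have "v (Suc k) \<bullet>c b = y (Suc k) \<bullet>c b + S (Suc k) \<bullet>c b"
      unfolding v_def using yc S b by (intro add_scalar_prod_distrib) auto
    then have c: "v (Suc k) \<bullet>c b = ?c"
      unfolding S_b using beta_scalar_prod[where x = x, OF assms(12,17)] by simp
    have "char_matrix ?M lam *\<^sub>v v (Suc k)
        = char_matrix A lam *\<^sub>v v (Suc k) + ?c \<cdot>\<^sub>v x m"
      unfolding c[symmetric]
      using assms(1,16) xm v k by (intro char_matrix_rank_one_mult_vec) auto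
    also have "char_matrix A lam *\<^sub>v v (Suc k) = y k + char_matrix A lam *\<^sub>v S (Suc k)"
      unfolding v_def using mult_add_distrib_mat_vec[OF N yc(1) S] y(3)[of k] k assms(15) by simp
    also have "\<dots> + ?c \<cdot>\<^sub>v x m = v k"
    proof (rule eq_vecI)
      fix i assume "i < dim_vec (v k)"
      then have i: "i < n"
        using v[of k] k by simp
      \<comment> \<open>The hypothesis \<open>z 0 = 0\<close> of \<open>beta_shift_sum\<close>; it
        reflects that \<open>x 1\<close> is an eigenvector of \<open>A\<close>.\<close>
      have "x 0 $ i = 0"
        using x(1) i by simp
      from beta_shift_sum[where z = "\<lambda>j. x j $ i", OF assms(12) this]
      have "(char_matrix A lam *\<^sub>v S (Suc k)) $ i + ?c * x m $ i = S k $ i"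
        using NS_idx[OF i] S_idx[OF i] by simp
      moreover have "dim_vec (S k) = n"
        using S[of k] by simp
      ultimately show "(y k + char_matrix A lam *\<^sub>v S (Suc k) + ?c \<cdot>\<^sub>v x m) $ i = v k $ i"
        unfolding v_def using yc xm i N by (simp add: add.assoc)
    qed (use v[of k] k xm in simp)
    finally show ?thesis .
  qed
  have v0: "v 0 = 0\<^sub>v n"
    unfolding v_def S_def using y(1) by (simp add: finsum_vec_empty del: finsum_vec)
  have v1: "v 1 \<noteq> 0\<^sub>v n"
  proof -
    have mem: "(p, 1) \<in> ?I" "(q, 1) \<in> ?I"
      using assms(4-8,12-15) by auto
    have "x 1 \<in> ?B" "y 1 \<in> ?B"
      using mem assms(10,11) by (metis (no_types, lifting) image_eqI case_prod_conv)+
    \<comment> \<open>A basis is a set here, so it would not by itself separate the two vectors;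
      injectivity of the family does, because \<open>p \<noteq> q\<close>.\<close>
    moreover have "x 1 \<noteq> y 1"
      using inj_onD[OF inj _ mem] assms(6,10,11) by auto
    moreover have "?B \<subseteq> carrier_vec n" "\<not> lin_dep ?B"
      using bas by (auto simp: basis_def)
    ultimately have "y 1 + beta b x y m 1 1 \<cdot>\<^sub>v x 1 \<noteq> 0\<^sub>v n"
      by (intro lin_indpt_add_smult_ne_0)
    moreover have "S 1 = beta b x y m 1 1 \<cdot>\<^sub>v x 1"
    proof (rule eq_vecI)
      have xc: "x 1 \<in> carrier_vec n"
        using x(2)[of 1] assms(12,13) by simp
      show "dim_vec (S 1) = dim_vec (beta b x y m 1 1 \<cdot>\<^sub>v x 1)"
        using S[of 1] xc by simp
      fix i assume "i < dim_vec (beta b x y m 1 1 \<cdot>\<^sub>v x 1)"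
      then have "i < n" "min 1 m = 1"
        using xc assms(12) by auto
      then show "S 1 $ i = (beta b x y m 1 1 \<cdot>\<^sub>v x 1) $ i"
        using S_idx[of i 1] xc by (simp del: beta.simps)
    qed
    ultimately show ?thesis
      by (simp add: v_def)
  qed
  have "gen_eigenvector ?M lam t (v t)"
    using M v step v0 v1 assms(14) by (rule gen_eigenvector_chain)
  then show ?thesis
    unfolding v_def S_def by (cases "t \<le> m") (simp_all add: min_def del: finsum_vec)
qed

end
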